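(* Let $G$ be a graph on $n$ vertices with no isolated vertices that satisfies both of the following conditions: (a) for every edge $uv$ of $G$, $d_G(u)+d_G(v)\ge 4$; (b) no two vertices of degree $1$ in $G$ are at distance exactly $4$ in $G$. Then $\gamma_{\rm tg}(G)\le \frac{3}{4}n$.
   Context: For a graph $G$ without isolated vertices, a vertex $x$ totally dominates a vertex $y$ if $x$ and $y$ are adjacent. The total domination game on $G$ is played by two players, Dominator and Staller, who alternately choose vertices of $G$, Dominator choosing first. A vertex may be chosen only if it totally dominates at least one vertex that is not totally dominated by the previously chosen vertices. The game ends when the set of chosen vertices is a total dominating set of $G$, i.e. every vertex of $G$ has a neighbor among the chosen vertices. Dominator wants to minimize the number of chosen vertices and Staller wants to maximize it. The game total domination number $\gamma_{\rm tg}(G)$ is the number of vertices chosen when Dominator starts and both players play optimally. A leaf is a vertex of degree $1$. *)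

theory Defs
  imports Complex_Main
begin

definition simple_graph :: "'a set \<Rightarrow> ('a \<Rightarrow> 'a \<Rightarrow> bool) \<Rightarrow> bool" where
  "simple_graph V E \<longleftrightarrow> finite V \<and> (\<forall>u v. E u v \<longrightarrow> u \<in> V \<and> v \<in> V)
     \<and> (\<forall>u v. E u v \<longrightarrow> E v u) \<and> (\<forall>u. \<not> E u u)"

definition nbhd :: "'a set \<Rightarrow> ('a \<Rightarrow> 'a \<Rightarrow> bool) \<Rightarrow> 'a \<Rightarrow> 'a set" where
  "nbhd V E v = {u \<in> V. E v u}"

definition degree :: "'a set \<Rightarrow> ('a \<Rightarrow> 'a \<Rightarrow> bool) \<Rightarrow> 'a \<Rightarrow> nat" where
  "degree V E v = card (nbhd V E v)"

definition no_isolated :: "'a set \<Rightarrow> ('a \<Rightarrow> 'a \<Rightarrow> bool) \<Rightarrow> bool" where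
  "no_isolated V E \<longleftrightarrow> (\<forall>v \<in> V. \<exists>u. E v u)"

inductive walk :: "('a \<Rightarrow> 'a \<Rightarrow> bool) \<Rightarrow> 'a \<Rightarrow> 'a \<Rightarrow> nat \<Rightarrow> bool" for E where
  walk_nil: "walk E u u 0"
| walk_cons: "E u w \<Longrightarrow> walk E w v k \<Longrightarrow> walk E u v (Suc k)"

definition dist_eq :: "('a \<Rightarrow> 'a \<Rightarrow> bool) \<Rightarrow> 'a \<Rightarrow> 'a \<Rightarrow> nat \<Rightarrow> bool" where
  "dist_eq E u v k \<longleftrightarrow> walk E u v k \<and> (\<forall>j<k. \<not> walk E u v j)"

text \<open>Minimax value of the total domination game. State: the set D of
  vertices already totally dominated. A vertex v is a legal move iff it totally
  dominates some not yet dominated vertex. The boolean says whether it is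
  Dominator's turn (minimizer) or Staller's (maximizer). The first argument is
  fuel; since every move dominates at least one new vertex, fuel card V suffices.\<close>
definition legal_moves :: "'a set \<Rightarrow> ('a \<Rightarrow> 'a \<Rightarrow> bool) \<Rightarrow> 'a set \<Rightarrow> 'a set" where
  "legal_moves V E D = {v \<in> V. nbhd V E v - D \<noteq> {}}"

primrec tdg_val :: "'a set \<Rightarrow> ('a \<Rightarrow> 'a \<Rightarrow> bool) \<Rightarrow> nat \<Rightarrow> bool \<Rightarrow> 'a set \<Rightarrow> nat" where
  "tdg_val V E 0 t D = 0"
| "tdg_val V E (Suc f) t D =
     (if V \<subseteq> D then 0
      else if t then 1 + Min ((\<lambda>v. tdg_val V E f False (D \<union> nbhd V E v)) ` legal_moves V E D)
      else 1 + Max ((\<lambda>v. tdg_val V E f True (D \<union> nbhd V E v)) ` legal_moves V E D))"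

definition game_total_domination_number :: "'a set \<Rightarrow> ('a \<Rightarrow> 'a \<Rightarrow> bool) \<Rightarrow> nat" where
  "game_total_domination_number V E = tdg_val V E (card V) True {}"

end

theory Submission
  imports Defs
begin

text \<open>
  Give every vertex that is not yet totally dominated weight 2 and every playable vertex weight 1,
  so that the initial weight is \<open>3n\<close>; we want moves to lower the weight by 4 on average.
  Every Staller move lowers it by at least 3, and Dominator lowers it by 5 as long as some
  vertex dominates two new vertices. When no such vertex is left, every move lowers the weight
  by 4, except that dominating a leaf may lower it by 3 only. To pay for those leaves, Dominator
  starts by playing neighbours of leaves (supports) that dominate at least three new vertices.
  The distance condition says that distinct supports with a common neighbour are adjacent.
  Hence the supports split into cliques whose neighbourhoods are disjoint, and the debt of each
  clique can be bounded separately: it is at most the number of its supports that still have to be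
  played, and at most twice the number of dominated vertices in its neighbourhood.
\<close>

locale total_domination_game =
  fixes V :: "'a set" and E :: "'a \<Rightarrow> 'a \<Rightarrow> bool"
  assumes graph: "simple_graph V E"
    and no_iso: "no_isolated V E"
    and degree_sum: "E u v \<Longrightarrow> degree V E u + degree V E v \<ge> 4"
    and leaf_dist: "u \<in> V \<Longrightarrow> v \<in> V \<Longrightarrow> degree V E u = 1 \<Longrightarrow> degree V E v = 1 \<Longrightarrow> \<not> dist_eq E u v 4"
begin

abbreviation N where "N \<equiv> nbhd V E"
abbreviation deg where "deg \<equiv> degree V E"
abbreviation legal where "legal \<equiv> legal_moves V E"
abbreviation val where "val \<equiv> tdg_val V E"

definition weight :: "'a set \<Rightarrow> nat" where
  "weight D = 2 * card (V - D) + card (legal D)"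

definition supports :: "'a set" where
  "supports = {v \<in> V. \<exists>u \<in> N v. deg u = 1}"

definition pending :: "'a set \<Rightarrow> 'a set \<Rightarrow> 'a set" where
  "pending D K = {v \<in> K. \<exists>u \<in> N v - D. deg u = 1}"

text \<open>This is the closed neighbourhood of \<open>v\<close> among the supports. That it is a
  clique, and the same set for each of its members, follows from the distance condition.\<close>

definition support_clique :: "'a \<Rightarrow> 'a set" where
  "support_clique v = {w \<in> supports. w = v \<or> E v w}"

definition cliques :: "'a set set" where
  "cliques = support_clique ` supports"

definition region :: "'a set \<Rightarrow> 'a set" where
  "region K = (\<Union>v\<in>K. N v)"

text \<open>The first argument of the minimum makes the debt zero at the start. The second is the
  amount that the endgame bound charges.\<close>

definition debt :: "'a set \<Rightarrow> nat" where
  "debt D = (\<Sum>K\<in>cliques. min (2 * card (region K \<inter> D)) (card (pending D K)))"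

section \<open>Basic facts on the graph and the game value\<close>

lemma finite_V [simp]: "finite V"
  using graph by (simp add: simple_graph_def)

lemma E_sym: "E u v \<Longrightarrow> E v u"
  using graph by (simp add: simple_graph_def)

lemma E_irrefl [simp]: "\<not> E u u"
  using graph by (simp add: simple_graph_def)

lemma E_in_V: "E u v \<Longrightarrow> u \<in> V \<and> v \<in> V"
  using graph by (simp add: simple_graph_def)

lemma in_N [simp]: "u \<in> N v \<longleftrightarrow> E v u"
  using E_in_V by (auto simp: nbhd_def)

lemma N_subset: "N v \<subseteq> V"
  by (auto simp: nbhd_def)

lemma finite_N [simp]: "finite (N v)"
  by (rule finite_subset[OF N_subset finite_V])

lemma card_N_split: "card (N v) = card (N v \<inter> D) + card (N v - D)"
  by (metis Un_Diff_Int Int_Diff_disjoint card_Un_disjoint finite_Diff finite_Int finite_N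
      add.commute inf_commute)

lemma finite_legal [simp]: "finite (legal D)"
  by (simp add: legal_moves_def)

lemma legal_nonempty: "\<not> V \<subseteq> D \<Longrightarrow> legal D \<noteq> {}"
  using no_iso E_sym E_in_V by (fastforce simp: no_isolated_def legal_moves_def)

lemma val_dominator:
  assumes "v \<in> legal D"
  shows "val (Suc f) True D \<le> 1 + val f False (D \<union> N v)"
proof (cases "V \<subseteq> D")
  case False
  have "Min ((\<lambda>v. val f False (D \<union> N v)) ` legal D) \<le> val f False (D \<union> N v)"
    using assms by (intro Min_le) auto
  then show ?thesis using False by simp
qed simp

lemma val_staller:
  assumes "\<And>v. v \<in> legal D \<Longrightarrow> 4 * val f True (D \<union> N v) + 4 \<le> b"
  shows "4 * val (Suc f) False D \<le> b"
proof (cases "V \<subseteq> D")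
  case False
  have "Max ((\<lambda>v. val f True (D \<union> N v)) ` legal D) \<in> (\<lambda>v. val f True (D \<union> N v)) ` legal D"
    using legal_nonempty[OF False] by (intro Max_in) auto
  then obtain v where "v \<in> legal D"
    and "Max ((\<lambda>v. val f True (D \<union> N v)) ` legal D) = val f True (D \<union> N v)" by blast
  then show ?thesis using assms[of v] False by simp
qed simp

section \<open>Weight lost in one move\<close>

text \<open>Each newly dominated vertex accounts for 2. The set \<open>X\<close> collects vertices
  that the move makes unplayable, and each of them accounts for 1.\<close>

lemma weight_drop:
  assumes "X \<subseteq> legal D" "X \<inter> legal (D \<union> N v) = {}"
  shows "weight (D \<union> N v) + 2 * card (N v - D) + card X \<le> weight D"
proof -
  have "V - D = (V - (D \<union> N v)) \<union> (N v - D)"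
    using N_subset by auto
  then have "card (V - D) = card ((V - (D \<union> N v)) \<union> (N v - D))"
    by (rule arg_cong)
  also have "\<dots> = card (V - (D \<union> N v)) + card (N v - D)"
    by (intro card_Un_disjoint) auto
  finally have "card (V - D) = card (V - (D \<union> N v)) + card (N v - D)" .
  moreover have "legal (D \<union> N v) \<union> X \<subseteq> legal D"
    using assms(1) by (auto simp: legal_moves_def)
  then have "card (legal (D \<union> N v) \<union> X) \<le> card (legal D)"
    by (intro card_mono) auto
  moreover have "card (legal (D \<union> N v) \<union> X) = card (legal (D \<union> N v)) + card X"
    using assms finite_subset[OF assms(1)] by (intro card_Un_disjoint) auto
  ultimately show ?thesis by (simp add: weight_def)
qed

lemma weight_drop_move:
  assumes "v \<in> legal D"
  shows "weight (D \<union> N v) + 2 * card (N v - D) + 1 \<le> weight D"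
  using weight_drop[of "{v}" D v] assms by (auto simp: legal_moves_def)

lemma card_residual_pos: "v \<in> legal D \<Longrightarrow> card (N v - D) \<ge> 1"
  by (auto simp: legal_moves_def Suc_le_eq card_gt_0_iff)

lemma legalI: "v \<in> V \<Longrightarrow> card (N v - D) \<ge> 1 \<Longrightarrow> v \<in> legal D"
  by (auto simp: legal_moves_def Suc_le_eq card_gt_0_iff)

section \<open>Leaves and supports\<close>

lemma leaf_N: "deg u = 1 \<Longrightarrow> E u v \<Longrightarrow> N u = {v}"
  by (metis card_1_singletonE degree_def in_N singletonD)

lemma supports_subset: "supports \<subseteq> V"
  by (auto simp: supports_def)

lemma finite_supports [simp]: "finite supports"
  by (rule finite_subset[OF supports_subset finite_V])

text \<open>The degree-sum condition, applied to the edge between a support and its leaf. In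
  particular no support is a leaf.\<close>

lemma supports_degree: "v \<in> supports \<Longrightarrow> deg v \<ge> 3"
  using degree_sum by (fastforce simp: supports_def)

lemma finite_pending [simp]: "finite K \<Longrightarrow> finite (pending D K)"
  by (simp add: pending_def)

lemma pending_mono: "finite K \<Longrightarrow> D \<subseteq> D' \<Longrightarrow> card (pending D' K) \<le> card (pending D K)"
  by (intro card_mono) (auto simp: pending_def)

section \<open>The game bounded by weight plus pending supports\<close>

text \<open>Every move \<open>v\<close>, by either player, dominates exactly one new vertex
  \<open>u\<close>. If \<open>u\<close> is a leaf, the weight drops by at least 3 and
  \<open>v\<close> stops being pending. Otherwise \<open>u\<close> has another neighbour
  \<open>w\<close>, whose only undominated neighbour is also \<open>u\<close>; both \<open>v\<close>
  and \<open>w\<close> become unplayable, and the weight drops by at least 2 + 2.\<close>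

lemma val_all_residual_le_one:
  assumes "\<forall>v\<in>V. card (N v - D) \<le> 1"
  shows "4 * val f t D \<le> weight D + card (pending D supports)"
  using assms
proof (induction f arbitrary: D t)
  case (Suc f)
  have move: "4 * val f t' (D \<union> N v) + 4 \<le> weight D + card (pending D supports)"
    if v: "v \<in> legal D" for v t'
  proof -
    have "\<forall>w\<in>V. card (N w - (D \<union> N v)) \<le> 1"
    proof
      fix w assume "w \<in> V"
      moreover have "card (N w - (D \<union> N v)) \<le> card (N w - D)"
        by (intro card_mono) auto
      ultimately show "card (N w - (D \<union> N v)) \<le> 1" using Suc.prems by fastforce
    qed
    from Suc.IH[OF this]
    have IH: "4 * val f t' (D \<union> N v) \<le> weight (D \<union> N v) + card (pending (D \<union> N v) supports)" .
    have vV: "v \<in> V" using v by (simp add: legal_moves_def)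
    then have "card (N v - D) = 1"
      using card_residual_pos[OF v] Suc.prems by fastforce
    then obtain u where u: "N v - D = {u}"
      by (meson card_1_singletonE)
    then have Evu: "E v u" "u \<notin> D" by auto
    have mono: "card (pending (D \<union> N v) supports) \<le> card (pending D supports)"
      by (rule pending_mono) auto
    show ?thesis
    proof (cases "deg u = 1")
      case True
      have "v \<in> pending D supports"
        using True Evu vV by (auto simp: pending_def supports_def)
      moreover have "pending (D \<union> N v) supports \<subseteq> pending D supports - {v}"
        by (auto simp: pending_def)
      ultimately have "pending (D \<union> N v) supports \<subset> pending D supports" by auto
      then have "card (pending (D \<union> N v) supports) < card (pending D supports)"
        by (intro psubset_card_mono) auto
      then show ?thesis
        using IH weight_drop_move[OF v] \<open>card (N v - D) = 1\<close> by simp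
    next
      case False
      have "N u \<noteq> {v}" using False by (auto simp: degree_def)
      then obtain w where w: "E u w" "w \<noteq> v"
        using E_sym[OF Evu(1)] by (metis in_N is_singletonI' is_singleton_def singletonD ex_in_conv)
      have wV: "w \<in> V" using w E_in_V by blast
      have "u \<in> N w - D" using w E_sym Evu by auto
      moreover have "card (N w - D) \<le> 1" using wV Suc.prems by blast
      ultimately have "N w - D = {u}"
        by (metis One_nat_def card_le_Suc0_iff_eq finite_Diff finite_N is_singletonI'
            is_singleton_the_elem singletonD empty_iff)
      then have "{v, w} \<subseteq> legal D" "{v, w} \<inter> legal (D \<union> N v) = {}"
        using v wV Evu by (auto simp: legal_moves_def)
      from weight_drop[OF this] w(2) \<open>card (N v - D) = 1\<close>
      have "weight (D \<union> N v) + 4 \<le> weight D" by simp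
      then show ?thesis using IH mono by simp
    qed
  qed
  show ?case
  proof (cases t)
    case True
    show ?thesis
    proof (cases "V \<subseteq> D")
      case False
      then obtain v where "v \<in> legal D" using legal_nonempty by blast
      then show ?thesis
        using move[of v False] val_dominator[of v D f] True by fastforce
    qed simp
  next
    case False
    then show ?thesis using val_staller[of D f] move by metis
  qed
qed simp

text \<open>A Staller move lowers the weight by at least 3, one short of 4; hence the slack 1. A
  Dominator move that dominates two new vertices lowers it by at least 5 and so pays for this slack.
  If no such move exists, the previous lemma applies.\<close>

lemma val_le_weight_plus_pending:
  "4 * val f True D \<le> weight D + card (pending D supports) \<and>
   4 * val f False D \<le> weight D + card (pending D supports) + 1"
proof (induction f arbitrary: D)
  case (Suc f)
  have mono: "card (pending (D \<union> N v) supports) \<le> card (pending D supports)" for v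
    by (rule pending_mono) auto
  have "4 * val (Suc f) True D \<le> weight D + card (pending D supports)"
  proof (cases "\<forall>v\<in>V. card (N v - D) \<le> 1")
    case True
    then show ?thesis by (rule val_all_residual_le_one)
  next
    case False
    then obtain v where v: "v \<in> V" "card (N v - D) \<ge> 2" by force
    then have vl: "v \<in> legal D" by (intro legalI) auto
    show ?thesis
      using val_dominator[OF vl, of f] Suc[of "D \<union> N v"] weight_drop_move[OF vl] mono[of v] v(2)
      by linarith
  qed
  moreover have "4 * val (Suc f) False D \<le> weight D + card (pending D supports) + 1"
  proof (rule val_staller)
    fix v assume v: "v \<in> legal D"
    show "4 * val f True (D \<union> N v) + 4 \<le> weight D + card (pending D supports) + 1"
      using Suc[of "D \<union> N v"] weight_drop_move[OF v] mono[of v] card_residual_pos[OF v]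
      by linarith
  qed
  ultimately show ?case by blast
qed simp

section \<open>The partition of the supports into cliques\<close>

text \<open>Otherwise leaves \<open>u\<close> at \<open>v\<close> and \<open>u'\<close> at
  \<open>w\<close> would be at distance exactly 4, along the walk \<open>u\<close>,
  \<open>v\<close>, \<open>x\<close>, \<open>w\<close>, \<open>u'\<close>.\<close>

lemma supports_common_neighbour:
  assumes "v \<in> supports" "w \<in> supports" "E v x" "E w x"
  shows "v = w \<or> E v w"
proof (rule ccontr)
  assume neg: "\<not> (v = w \<or> E v w)"
  obtain u where u: "E v u" "deg u = 1" using assms by (auto simp: supports_def)
  obtain u' where u': "E w u'" "deg u' = 1" using assms by (auto simp: supports_def)
  have Nu: "E u y \<longleftrightarrow> y = v" for y using leaf_N[OF u(2) E_sym[OF u(1)]] by (metis in_N singleton_iff)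
  have Nu': "E y u' \<longleftrightarrow> y = w" for y
    using leaf_N[OF u'(2) E_sym[OF u'(1)]] E_sym by (metis in_N singleton_iff)
  have "u' \<noteq> v" using supports_degree[OF assms(1)] u' by auto
  have "walk E u u' (Suc (Suc (Suc (Suc 0))))"
    using walk_cons[of E] walk_nil[of E] E_sym u(1) assms(3,4) u'(1) by metis
  \<comment> \<open>A nontrivial walk leaves \<open>u\<close> through \<open>v\<close> and enters
    \<open>u'\<close> through \<open>w\<close>. So length 0 or 2 would force \<open>v = w\<close>,
    length 1 would make the support \<open>v\<close> a leaf, and length 3 would make
    \<open>v\<close> and \<open>w\<close> adjacent.\<close>
  moreover have "\<not> walk E u u' j" if "j < 4" for j
  proof
    assume wk: "walk E u u' j"
    have w0: "walk E a b 0 \<longleftrightarrow> a = b" for a b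
      by (auto elim: walk.cases intro: walk.intros)
    have wS: "walk E a b (Suc k) \<longleftrightarrow> (\<exists>c. E a c \<and> walk E c b k)" for a b k
      by (auto elim: walk.cases intro: walk.intros)
    consider "j = 0" | "j = Suc 0" | "j = Suc (Suc 0)" | "j = Suc (Suc (Suc 0))"
      using \<open>j < 4\<close> by linarith
    then show False
    proof cases
      case 1
      then have "u = u'" using wk w0 by simp
      then show False using Nu[of w] E_sym[OF u'(1)] neg by simp
    next
      case 2
      then show False using wk \<open>u' \<noteq> v\<close> by (simp add: w0 wS Nu)
    next
      case 3
      then show False using wk neg by (simp add: w0 wS Nu Nu')
    next
      case 4
      then show False using wk neg by (auto simp: w0 wS Nu Nu')
    qed
  qed
  ultimately have "dist_eq E u u' 4"
    by (simp add: dist_eq_def numeral_eq_Suc)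
  then show False using leaf_dist[of u u'] u u' E_in_V by blast
qed

text \<open>Being equal or adjacent is transitive on supports: two neighbours of a support have that
  support as a common neighbour.\<close>

lemma support_clique_eq:
  assumes "v \<in> supports" "w \<in> support_clique v"
  shows "support_clique w = support_clique v"
  using assms supports_common_neighbour E_sym unfolding support_clique_def by blast

lemma cliquesD:
  assumes "K \<in> cliques"
  shows "K \<subseteq> supports" "v \<in> K \<Longrightarrow> K = support_clique v" "finite K"
proof -
  show sub: "K \<subseteq> supports" using assms by (auto simp: cliques_def support_clique_def)
  show "v \<in> K \<Longrightarrow> K = support_clique v"
    using assms support_clique_eq by (auto simp: cliques_def)
  show "finite K" by (rule finite_subset[OF sub finite_supports])
qed

lemma support_clique_in_cliques:
  "v \<in> supports \<Longrightarrow> support_clique v \<in> cliques \<and> v \<in> support_clique v"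
  by (auto simp: cliques_def support_clique_def)

lemma finite_cliques [simp]: "finite cliques"
  by (simp add: cliques_def)

lemma finite_region [simp]: "finite (region K)"
  by (rule finite_subset[OF _ finite_V]) (auto simp: region_def dest: E_in_V)

lemma cliques_disjoint: "K \<in> cliques \<Longrightarrow> K' \<in> cliques \<Longrightarrow> K \<noteq> K' \<Longrightarrow> K \<inter> K' = {}"
  using cliquesD(2) by blast

text \<open>A vertex in both regions would be a common neighbour of two supports from different
  cliques, which would then be equal or adjacent.\<close>

lemma region_disjoint:
  assumes "K \<in> cliques" "K' \<in> cliques" "K \<noteq> K'"
  shows "region K \<inter> region K' = {}"
proof (rule ccontr)
  assume "region K \<inter> region K' \<noteq> {}"
  then obtain v w x where vw: "v \<in> K" "w \<in> K'" "E v x" "E w x"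
    by (auto simp: region_def)
  have vs: "v \<in> supports" "w \<in> supports" using vw assms cliquesD(1) by blast+
  then have "w \<in> support_clique v"
    using supports_common_neighbour[OF vs vw(3,4)] by (auto simp: support_clique_def)
  then have "w \<in> K" using vw assms cliquesD(2) by blast
  then show False using cliques_disjoint[OF assms] vw by blast
qed

lemma pending_supports:
  "card (pending D supports) = (\<Sum>K\<in>cliques. card (pending D K))"
proof -
  have "pending D supports = (\<Union>K\<in>cliques. pending D K)"
    using support_clique_in_cliques cliquesD(1) unfolding pending_def by fastforce
  moreover have "card (\<Union>K\<in>cliques. pending D K) = (\<Sum>K\<in>cliques. card (pending D K))"
    using cliques_disjoint cliquesD(3)
    by (intro card_UN_disjoint) (auto simp: pending_def)
  ultimately show ?thesis by simp
qed

text \<open>The neighbours of \<open>v\<close> include all other members of \<open>K\<close> and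
  also a leaf, which lies outside \<open>K\<close> and makes up for \<open>v\<close> itself.\<close>

lemma card_clique_le_degree:
  assumes "K \<in> cliques" "v \<in> K"
  shows "card K \<le> card (N v)"
proof -
  have vs: "v \<in> supports" using assms cliquesD(1) by blast
  then obtain u where u: "E v u" "deg u = 1" by (auto simp: supports_def)
  have "u \<notin> K" using u cliquesD(1)[OF assms(1)] supports_degree by fastforce
  have "insert u (K - {v}) \<subseteq> N v"
    using u cliquesD(2)[OF assms] by (auto simp: support_clique_def)
  then have "card (insert u (K - {v})) \<le> card (N v)" by (intro card_mono) auto
  moreover have "card (insert u (K - {v})) = Suc (card (K - {v}))"
    using \<open>u \<notin> K\<close> cliquesD(3)[OF assms(1)] by (intro card_insert_disjoint) auto
  ultimately show ?thesis
    using card.remove[OF cliquesD(3)[OF assms(1)] assms(2)] by linarith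
qed

section \<open>How the debt evolves during play\<close>

lemma N_subset_region: "v \<in> K \<Longrightarrow> N v \<subseteq> region K"
  by (auto simp: region_def)

lemma card_N_Int_le_region: "v \<in> K \<Longrightarrow> card (N v \<inter> D) \<le> card (region K \<inter> D)"
  using N_subset_region by (intro card_mono) auto

text \<open>Shows that the debt equals the number of pending supports as soon as no support has
  three undominated neighbours, so that the endgame bound can take over.\<close>

lemma pending_le_twice_dominated:
  assumes small: "\<And>v. v \<in> supports \<Longrightarrow> card (N v - D) \<le> 2" and K: "K \<in> cliques"
  shows "card (pending D K) \<le> 2 * card (region K \<inter> D)"
proof (rule ccontr)
  assume neg: "\<not> ?thesis"
  define m h L where "m = card K" and "h = card (region K \<inter> D)" and "L = card (pending D K)"
  have "pending D K \<subseteq> K" by (auto simp: pending_def)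
  then have Lm: "L \<le> m"
    using cliquesD(3)[OF K] by (simp add: L_def m_def card_mono)
  have hit: "card (N v \<inter> D) \<ge> m - 2 \<and> card (N v \<inter> D) \<ge> 1" if "v \<in> K" for v
  proof -
    have "v \<in> supports" using that K cliquesD(1) by blast
    then show ?thesis
      using small[of v] supports_degree[of v] card_N_split[of v D] card_clique_le_degree[OF K that]
      by (simp add: degree_def m_def)
  qed
  obtain v where v: "v \<in> K" using K support_clique_in_cliques by (auto simp: cliques_def)
  have "h \<ge> m - 2" "h \<ge> 1"
    using hit[OF v] card_N_Int_le_region[OF v, of D] by (auto simp: h_def)
  \<comment> \<open>A counterexample has \<open>2 * h < L\<close> and \<open>L \<le> m\<close>. With
    \<open>h \<ge> m - 2\<close> this gives \<open>m \<le> 3\<close>, and with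
    \<open>h \<ge> 1\<close> it gives \<open>L \<ge> 3\<close>.\<close>
  then have m: "m = 3" "L = 3" "h = 1"
    using neg Lm unfolding h_def[symmetric] L_def[symmetric] by linarith+
  then obtain x where x: "region K \<inter> D = {x}"
    by (metis card_1_singletonE h_def)
  have Ex: "E w x" if "w \<in> K" for w
  proof -
    have "N w \<inter> D \<noteq> {}" using hit[OF that] by auto
    then show ?thesis using x N_subset_region[OF that] by auto
  qed
  then have "x \<notin> K" using E_irrefl by blast
  have "pending D K = K"
    using m \<open>pending D K \<subseteq> K\<close> cliquesD(3)[OF K] by (simp add: L_def m_def card_subset_eq)
  then have "v \<in> pending D K" using v by blast
  then obtain u where u: "E v u" "u \<notin> D" "deg u = 1" by (auto simp: pending_def)
  have "u \<notin> K" using u cliquesD(1)[OF K] supports_degree by fastforce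
  \<comment> \<open>The only dominated vertex of the region, \<open>x\<close>, is adjacent to all of
    \<open>K\<close> and hence outside \<open>K\<close>. So \<open>v\<close> has three undominated
    neighbours: the two other members of \<open>K\<close> and its leaf \<open>u\<close>.\<close>
  have "insert u (K - {v}) \<subseteq> N v - D"
  proof -
    have adj: "E v w" if "w \<in> K" "w \<noteq> v" for w
      using cliquesD(2)[OF K v] that unfolding support_clique_def by blast
    moreover have "w \<notin> D" if "w \<in> K" "w \<noteq> v" for w
    proof
      assume "w \<in> D"
      moreover have "w \<in> region K" using adj[OF that] N_subset_region[OF v] in_N by blast
      ultimately have "w \<in> {x}" unfolding x[symmetric] by simp
      then show False using \<open>x \<notin> K\<close> that by simp
    qed
    ultimately show ?thesis using u by auto
  qed
  then have "card (insert u (K - {v})) \<le> card (N v - D)" by (intro card_mono) auto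
  moreover have "card (insert u (K - {v})) = 3"
    using \<open>u \<notin> K\<close> v m cliquesD(3)[OF K] by (simp add: m_def)
  moreover have "v \<in> supports" using v K cliquesD(1) by blast
  ultimately show False using small[of v] by simp
qed

text \<open>Regions are disjoint, so a newly dominated vertex raises the first argument of the
  minimum for at most one clique, by 2, while the pending counts never grow.\<close>

lemma debt_staller: "debt (D \<union> N v) \<le> debt D + 2 * card (N v - D)"
proof -
  have "min (2 * card (region K \<inter> (D \<union> N v))) (card (pending (D \<union> N v) K))
      \<le> min (2 * card (region K \<inter> D)) (card (pending D K)) + 2 * card (region K \<inter> (N v - D))"
    if K: "K \<in> cliques" for K
  proof -
    have "region K \<inter> (D \<union> N v) = (region K \<inter> D) \<union> (region K \<inter> (N v - D))" by auto
    then have "card (region K \<inter> (D \<union> N v)) \<le> card (region K \<inter> D) + card (region K \<inter> (N v - D))"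
      by (metis card_Un_le)
    moreover have "card (pending (D \<union> N v) K) \<le> card (pending D K)"
      using cliquesD(3)[OF K] by (intro pending_mono) auto
    ultimately show ?thesis by linarith
  qed
  then have "debt (D \<union> N v) \<le> (\<Sum>K\<in>cliques. min (2 * card (region K \<inter> D)) (card (pending D K))
      + 2 * card (region K \<inter> (N v - D)))"
    unfolding debt_def by (rule sum_mono)
  also have "\<dots> = debt D + 2 * (\<Sum>K\<in>cliques. card (region K \<inter> (N v - D)))"
    by (simp add: debt_def sum.distrib sum_distrib_left)
  also have "(\<Sum>K\<in>cliques. card (region K \<inter> (N v - D))) = card (\<Union>K\<in>cliques. region K \<inter> (N v - D))"
    using region_disjoint by (intro card_UN_disjoint[symmetric]) auto
  also have "\<dots> \<le> card (N v - D)" by (intro card_mono) auto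
  finally show ?thesis by simp
qed

text \<open>Playing \<open>v\<close> dominates every other member of its clique. Each member that
  was undominated has a leaf adjacent to nothing else, and this leaf becomes unplayable.\<close>

lemma weight_drop_support:
  assumes v: "v \<in> supports" and K: "K = support_clique v" and big: "card (N v - D) \<ge> 3"
  shows "weight (D \<union> N v) + 2 * card (N v - D) + 1 + card (K - {v} - D) \<le> weight D"
proof -
  define leaf where "leaf w = (SOME u. E w u \<and> deg u = 1)" for w
  have leaf: "E w (leaf w) \<and> deg (leaf w) = 1" if "w \<in> supports" for w
  proof -
    have "\<exists>u. E w u \<and> deg u = 1" using that by (auto simp: supports_def)
    then show ?thesis unfolding leaf_def by (rule someI_ex)
  qed
  have N_leaf: "N (leaf w) = {w}" if "w \<in> supports" for w
    using leaf[OF that] leaf_N E_sym by blast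
  define Y where "Y = K - {v} - D"
  have Ysub: "Y \<subseteq> supports" "Y \<subseteq> N v" "Y \<inter> D = {}"
    using K by (auto simp: Y_def support_clique_def)
  then have finY: "finite Y" using finite_subset finite_supports by blast
  \<comment> \<open>A leaf determines its support as its only neighbour.\<close>
  have "inj_on leaf Y"
    by (rule inj_onI) (metis N_leaf Ysub(1) singleton_inject subsetD)
  then have "card (leaf ` Y) = card Y" by (rule card_image)
  moreover have "v \<notin> leaf ` Y"
    using leaf Ysub(1) supports_degree[OF v] by fastforce
  ultimately have "card (insert v (leaf ` Y)) = card Y + 1" using finY by simp
  moreover have "insert v (leaf ` Y) \<subseteq> legal D"
  proof -
    have "leaf w \<in> legal D" if "w \<in> Y" for w
    proof -
      have ws: "w \<in> supports" "w \<notin> D" using that Ysub by auto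
      then show ?thesis using N_leaf[OF ws(1)] leaf[OF ws(1)] E_in_V
        by (auto simp: legal_moves_def)
    qed
    moreover have "v \<in> legal D" using v big supports_subset by (intro legalI) auto
    ultimately show ?thesis by blast
  qed
  moreover have "insert v (leaf ` Y) \<inter> legal (D \<union> N v) = {}"
  proof -
    have "leaf w \<notin> legal (D \<union> N v)" if "w \<in> Y" for w
    proof -
      have "w \<in> supports" "w \<in> N v" using that Ysub by blast+
      then have "N (leaf w) \<subseteq> N v" using N_leaf by simp
      then show ?thesis by (auto simp: legal_moves_def)
    qed
    then show ?thesis by (auto simp: legal_moves_def)
  qed
  ultimately show ?thesis
    using weight_drop[of "insert v (leaf ` Y)" D v] by (simp add: Y_def)
qed

text \<open>Of the drop by 7, 4 pays for this move and 3 covers what the following Staller move may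
  fall short of 4.\<close>

lemma debt_dominator:
  assumes v: "v \<in> supports" and big: "card (N v - D) \<ge> 3"
  shows "weight (D \<union> N v) + debt (D \<union> N v) + 7 \<le> weight D + debt D"
proof -
  define K where "K = support_clique v"
  have K: "K \<in> cliques" and vK: "v \<in> K"
    using support_clique_in_cliques[OF v] by (auto simp: K_def)
  define D' where "D' = D \<union> N v"
  define clique_debt where "clique_debt D K = min (2 * card (region K \<inter> D)) (card (pending D K))" for D K
  have debt_split: "debt D = clique_debt D K + (\<Sum>K\<in>cliques - {K}. clique_debt D K)" for D
    unfolding debt_def clique_debt_def[symmetric] using K by (intro sum.remove) auto
  \<comment> \<open>The move dominates only vertices in the region of \<open>K\<close>, which is
    disjoint from the other regions.\<close>
  have "clique_debt D' K' = clique_debt D K'" if "K' \<in> cliques - {K}" for K'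
  proof -
    have "region K' \<inter> N v = {}"
      using region_disjoint[of K K'] that K N_subset_region[OF vK] by blast
    then have "region K' \<inter> D' = region K' \<inter> D" "pending D' K' = pending D K'"
      unfolding D'_def pending_def region_def by blast+
    then show ?thesis by (simp add: clique_debt_def)
  qed
  then have rest: "(\<Sum>K\<in>cliques - {K}. clique_debt D' K) = (\<Sum>K\<in>cliques - {K}. clique_debt D K)"
    by (intro sum.cong) auto
  define m h L L' r a where "m = card K" and "h = card (region K \<inter> D)"
    and "L = card (pending D K)" and "L' = card (pending D' K)"
    and "r = card (N v - D)" and "a = card (K - {v} - D)"
  have finK: "finite K" using cliquesD(3)[OF K] .
  have "L' \<le> L"
    unfolding L'_def L_def by (rule pending_mono) (auto simp: D'_def finK)
  have "pending D' K \<subseteq> K - {v}" by (auto simp: pending_def D'_def)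
  then have "L' \<le> card (K - {v})" unfolding L'_def using finK by (intro card_mono) auto
  then have "L' + 1 \<le> m"
    using card.remove[OF finK vK] by (simp only: m_def)
  have "m \<le> r + h"
    using card_clique_le_degree[OF K vK] card_N_split[of v D] card_N_Int_le_region[OF vK, of D]
    by (simp add: m_def r_def h_def)
  \<comment> \<open>All members of \<open>K\<close> other than \<open>v\<close> are neighbours of
    \<open>v\<close>, hence in the region: the undominated ones are counted by \<open>a\<close>, the
    dominated ones by \<open>h\<close>.\<close>
  have "m \<le> a + h + 1"
  proof -
    have "K \<subseteq> insert v ((K - {v} - D) \<union> (region K \<inter> D))"
      using N_subset_region[OF vK] by (auto simp: K_def support_clique_def)
    then have "m \<le> card (insert v ((K - {v} - D) \<union> (region K \<inter> D)))"
      unfolding m_def using finK by (intro card_mono) auto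
    also have "\<dots> \<le> card ((K - {v} - D) \<union> (region K \<inter> D)) + 1"
      by (simp add: card_insert_le_m1 card_insert_if finK)
    also have "\<dots> \<le> a + h + 1"
      using card_Un_le by (simp add: a_def h_def)
    finally show ?thesis .
  qed
  have "r \<ge> 3" using big by (simp add: r_def)
  have "L' + 7 \<le> min (2 * h) L + 2 * r + 1 + a"
  \<comment> \<open>In the first case \<open>L'\<close> is at most the minimum, and
    \<open>2 * r + 1 \<ge> 7\<close> suffices. In the second the minimum is \<open>2 * h\<close>,
    and the excess of \<open>L'\<close> over it is covered by
    \<open>a \<ge> m - h - 1\<close>.\<close>
  proof (cases "L \<le> 2 * h \<or> m \<le> 2 * h + 1")
    case True
    then show ?thesis using \<open>L' \<le> L\<close> \<open>r \<ge> 3\<close> \<open>L' + 1 \<le> m\<close> by linarith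
  next
    case False
    then have "2 * m \<ge> h + 6 \<or> (m = 2 \<and> h = 0)" by linarith
    then show ?thesis
      using False \<open>r \<ge> 3\<close> \<open>L' + 1 \<le> m\<close> \<open>m \<le> r + h\<close> \<open>m \<le> a + h + 1\<close> by linarith
  qed
  moreover have "clique_debt D' K \<le> L'" by (simp add: clique_debt_def L'_def)
  moreover have "clique_debt D K = min (2 * h) L" by (simp add: clique_debt_def h_def L_def)
  moreover have "weight D' + 2 * r + 1 + a \<le> weight D"
    using weight_drop_support[OF v K_def big] by (simp add: D'_def r_def a_def)
  ultimately show ?thesis
    using debt_split[of D] debt_split[of D'] rest unfolding D'_def[symmetric] by linarith
qed

section \<open>Dominator's strategy and the final bound\<close>

text \<open>A Staller move dominating \<open>k\<close> new vertices lowers the weight by at least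
  \<open>2 * k + 1\<close> and raises the debt by at most \<open>2 * k\<close>. The sum drops by at
  least 1, which is 3 short of 4; hence the slack 3.\<close>

lemma val_le_weight_plus_debt:
  "4 * val f True D \<le> weight D + debt D \<and> 4 * val f False D \<le> weight D + debt D + 3"
proof (induction f arbitrary: D)
  case (Suc f)
  have "4 * val (Suc f) True D \<le> weight D + debt D"
  proof (cases "\<exists>v\<in>supports. card (N v - D) \<ge> 3")
    case True
    then obtain v where v: "v \<in> supports" "card (N v - D) \<ge> 3" by blast
    then have "v \<in> legal D" using supports_subset by (intro legalI) auto
    from val_dominator[OF this, of f] show ?thesis
      using Suc[of "D \<union> N v"] debt_dominator[OF v] by linarith
  next
    case False
    \<comment> \<open>From here on Dominator abandons the supports: the debt is the pending count,
      and the earlier bound covers the rest of the game.\<close>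
    then have "card (pending D K) \<le> 2 * card (region K \<inter> D)" if "K \<in> cliques" for K
      using that by (intro pending_le_twice_dominated) force+
    then have "debt D = card (pending D supports)"
      unfolding debt_def pending_supports by (intro sum.cong) auto
    then show ?thesis using val_le_weight_plus_pending[of "Suc f" D] by simp
  qed
  moreover have "4 * val (Suc f) False D \<le> weight D + debt D + 3"
  proof (rule val_staller)
    fix v assume "v \<in> legal D"
    from weight_drop_move[OF this]
    show "4 * val f True (D \<union> N v) + 4 \<le> weight D + debt D + 3"
      using Suc[of "D \<union> N v"] debt_staller[of D v] by linarith
  qed
  ultimately show ?case by blast
qed simp

lemma game_total_domination_number_le:
  "4 * game_total_domination_number V E \<le> 3 * card V"
proof -
  have "card (legal {}) \<le> card V"
    by (intro card_mono) (auto simp: legal_moves_def)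
  then have "weight {} \<le> 3 * card V" by (simp add: weight_def)
  moreover have "debt {} = 0" by (simp add: debt_def)
  ultimately show ?thesis
    using val_le_weight_plus_debt[of "card V" "{}"]
    by (simp add: game_total_domination_number_def)
qed

end

theorem theorem2:
  fixes V :: "'a set" and E :: "'a \<Rightarrow> 'a \<Rightarrow> bool"
  assumes "simple_graph V E"
    and "no_isolated V E"
    and "\<forall>u v. E u v \<longrightarrow> degree V E u + degree V E v \<ge> 4"
    and "\<forall>u \<in> V. \<forall>v \<in> V. degree V E u = 1 \<and> degree V E v = 1 \<longrightarrow> \<not> dist_eq E u v 4"
  shows "real (game_total_domination_number V E) \<le> 3 / 4 * real (card V)"
proof -
  interpret total_domination_game V E
    using assms by unfold_locales auto
  show ?thesis using game_total_domination_number_le by simp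
qed

end
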